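(* Let $I$ be a set and let $C$ be a set of triples $(J,K,L)$ of subsets of $I$ such that $L=\emptyset$ for every $(J,K,L)\in C$. For any family $\mathcal{F}=\{F_i\mid i\in I\}$ of simple graphs, let $\mathbf{P}(\mathcal{F})$ be the simple graph with vertex set $\prod_{i\in I}V(F_i)$ in which distinct vertices $f,g$ are adjacent iff $(J(fg),K(fg),L(fg))\in C$, where $J(fg)=\{j\in I\mid f(j)g(j)\in E(F_j)\}$, $K(fg)=\{k\in I\mid f(k)=g(k)\}$, $L(fg)=I\setminus(J(fg)\cup K(fg))$. Let $\mathcal{G}=\{G_i\mid i\in I\}$ and $\mathcal{H}=\{H_i\mid i\in I\}$ be families of simple graphs, let $\varphi_i:G_i\to H_i$ be a homomorphism for each $i\in I$, and let $\varphi:\prod_{i\in I}V(G_i)\to\prod_{i\in I}V(H_i)$ be defined by $\varphi(f)(i)=\varphi_i(f(i))$ for all $f$ and $i$. Then $\varphi$ is a homomorphism $\mathbf{P}(\mathcal{G})\to\mathbf{P}(\mathcal{H})$ (i.e. $\mathbf{P}$ is hom-preserving).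
   Context: Simple graphs are undirected, without loops or multiple edges, with non-empty vertex sets; $xy$ denotes the unordered pair $\{x,y\}$. The Cartesian product $\prod_{i\in I}V_i$ is the set of functions $f:I\to\bigsqcup_iV_i$ with $f(i)\in V_i$ for all $i$. A homomorphism is an edge-preserving map between vertex sets. The setup formalizes the paper's notion of a constraint-determined product process $\mathbf{P}$ (adjacency in the product is decided exactly by whether the triple $(J(fg),K(fg),L(fg))$ satisfies the $\mathbf{P}$-constraints) having $L=\emptyset$ among its constraints; examples are the Cartesian, direct and strong products. A process is hom-preserving if the induced map $\varphi$ is always a homomorphism between the products. *)

theory Defs
  imports Main "HOL-Library.FuncSet"
begin

record 'a ugraph =
  verts :: "'a set"
  edges :: "'a set set"

definition simple_graph :: "'a ugraph \<Rightarrow> bool" where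
  "simple_graph G \<longleftrightarrow>
     verts G \<noteq> {} \<and>
     (\<forall>e\<in>edges G. \<exists>x\<in>verts G. \<exists>y\<in>verts G. x \<noteq> y \<and> e = {x, y})"

definition graph_hom :: "'a ugraph \<Rightarrow> 'b ugraph \<Rightarrow> ('a \<Rightarrow> 'b) \<Rightarrow> bool" where
  "graph_hom G H h \<longleftrightarrow>
     h \<in> verts G \<rightarrow> verts H \<and>
     (\<forall>x\<in>verts G. \<forall>y\<in>verts G. {x, y} \<in> edges G \<longrightarrow> {h x, h y} \<in> edges H)"

definition adj_coords :: "'i set \<Rightarrow> ('i \<Rightarrow> 'a ugraph) \<Rightarrow> ('i \<Rightarrow> 'a) \<Rightarrow> ('i \<Rightarrow> 'a) \<Rightarrow> 'i set" where
  "adj_coords I F f g = {j\<in>I. {f j, g j} \<in> edges (F j)}"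

definition eq_coords :: "'i set \<Rightarrow> ('i \<Rightarrow> 'a) \<Rightarrow> ('i \<Rightarrow> 'a) \<Rightarrow> 'i set" where
  "eq_coords I f g = {k\<in>I. f k = g k}"

definition rest_coords :: "'i set \<Rightarrow> ('i \<Rightarrow> 'a ugraph) \<Rightarrow> ('i \<Rightarrow> 'a) \<Rightarrow> ('i \<Rightarrow> 'a) \<Rightarrow> 'i set" where
  "rest_coords I F f g = I - (adj_coords I F f g \<union> eq_coords I f g)"

text \<open>
  The product process determined by a constraint set \<open>C\<close> of triples \<open>(J, K, L)\<close>.
  Vertices are extensional functions, so that equality of vertices is equality
  of functions with domain \<open>I\<close>.
\<close>

definition product_process ::
  "'i set \<Rightarrow> ('i set \<times> 'i set \<times> 'i set) set \<Rightarrow> ('i \<Rightarrow> 'a ugraph) \<Rightarrow> ('i \<Rightarrow> 'a) ugraph" where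
  "product_process I C F =
     \<lparr>verts = (\<Pi>\<^sub>E i\<in>I. verts (F i)),
      edges = {{f, g} | f g.
        f \<in> (\<Pi>\<^sub>E i\<in>I. verts (F i)) \<and> g \<in> (\<Pi>\<^sub>E i\<in>I. verts (F i)) \<and> f \<noteq> g \<and>
        (adj_coords I F f g, eq_coords I f g, rest_coords I F f g) \<in> C}\<rparr>"

definition induced_map :: "'i set \<Rightarrow> ('i \<Rightarrow> 'a \<Rightarrow> 'b) \<Rightarrow> ('i \<Rightarrow> 'a) \<Rightarrow> ('i \<Rightarrow> 'b)" where
  "induced_map I \<phi> f = (\<lambda>i\<in>I. \<phi> i (f i))"

lemma coords_commute:
  "adj_coords I F f g = adj_coords I F g f"
  "eq_coords I f g = eq_coords I g f"
  "rest_coords I F f g = rest_coords I F g f"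
  by (auto simp: adj_coords_def eq_coords_def rest_coords_def insert_commute)

lemma product_process_adjacent_iff:
  assumes "f \<in> verts (product_process I C F)" "g \<in> verts (product_process I C F)" "f \<noteq> g"
  shows "{f, g} \<in> edges (product_process I C F) \<longleftrightarrow>
         (adj_coords I F f g, eq_coords I f g, rest_coords I F f g) \<in> C"
proof -
  have "{f, g} \<in> edges (product_process I C F) \<longleftrightarrow>
        (\<exists>f' g'. {f, g} = {f', g'} \<and>
          f' \<in> verts (product_process I C F) \<and> g' \<in> verts (product_process I C F) \<and> f' \<noteq> g' \<and>
          (adj_coords I F f' g', eq_coords I f' g', rest_coords I F f' g') \<in> C)"
    by (simp add: product_process_def)
  also have "\<dots> \<longleftrightarrow> (adj_coords I F f g, eq_coords I f g, rest_coords I F f g) \<in> C"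
    using assms by (metis coords_commute doubleton_eq_iff)
  finally show ?thesis .
qed

lemma simple_graph_product_process:
  assumes "\<And>i. i \<in> I \<Longrightarrow> simple_graph (F i)"
  shows "simple_graph (product_process I C F)"
  unfolding simple_graph_def
proof (intro conjI ballI)
  show "verts (product_process I C F) \<noteq> {}"
    using assms by (simp add: product_process_def simple_graph_def PiE_eq_empty_iff)
next
  fix e
  assume "e \<in> edges (product_process I C F)"
  then show "\<exists>x\<in>verts (product_process I C F). \<exists>y\<in>verts (product_process I C F). x \<noteq> y \<and> e = {x, y}"
    unfolding product_process_def ugraph.simps by blast
qed

end

theory Submission
  imports Defs
begin

text \<open>
  A homomorphism keeps adjacent coordinates adjacent and equal coordinates equal.
  If \<open>L(fg)\<close> is empty then \<open>J(fg)\<close> and \<open>K(fg)\<close> partition the index set, so, as the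
  target graphs are loopless, the triple of the images coincides with that of \<open>f\<close> and \<open>g\<close>.
  The images are distinct because \<open>J(fg)\<close> is non-empty.
\<close>

text \<open>Looplessness in usable form. It serves twice: for the factor graphs, to separate
  adjacent from equal coordinates, and for the product graph, to read off that the ends of an edge
  differ.\<close>

lemma edge_distinct:
  assumes "simple_graph F" "{x, y} \<in> edges F"
  shows "x \<noteq> y"
proof -
  obtain a b where "a \<noteq> b" "{x, y} = {a, b}"
    using assms unfolding simple_graph_def by blast
  then show ?thesis
    by (auto simp: doubleton_eq_iff)
qed

lemma induced_map_in_PiE:
  assumes "\<And>i. i \<in> I \<Longrightarrow> graph_hom (G i) (H i) (\<phi> i)"
    and "f \<in> (\<Pi>\<^sub>E i\<in>I. verts (G i))"
  shows "induced_map I \<phi> f \<in> (\<Pi>\<^sub>E i\<in>I. verts (H i))"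
  unfolding induced_map_def
proof (rule restrict_PiE_iff[THEN iffD2], rule ballI)
  fix i assume "i \<in> I"
  with assms(1)[of i] PiE_mem[OF assms(2)] show "\<phi> i (f i) \<in> verts (H i)"
    by (auto simp: graph_hom_def)
qed

lemma eq_coords_subset_induced_map:
  "eq_coords I f g \<subseteq> eq_coords I (induced_map I \<phi> f) (induced_map I \<phi> g)"
  by (auto simp: eq_coords_def induced_map_def)

lemma adj_coords_subset_induced_map:
  assumes "\<And>i. i \<in> I \<Longrightarrow> graph_hom (G i) (H i) (\<phi> i)"
    and "f \<in> (\<Pi>\<^sub>E i\<in>I. verts (G i))" "g \<in> (\<Pi>\<^sub>E i\<in>I. verts (G i))"
  shows "adj_coords I G f g \<subseteq> adj_coords I H (induced_map I \<phi> f) (induced_map I \<phi> g)"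
proof
  fix i assume "i \<in> adj_coords I G f g"
  then have "i \<in> I" "{f i, g i} \<in> edges (G i)"
    by (auto simp: adj_coords_def)
  moreover from \<open>i \<in> I\<close> assms(2,3) have "f i \<in> verts (G i)" "g i \<in> verts (G i)"
    by auto
  ultimately show "i \<in> adj_coords I H (induced_map I \<phi> f) (induced_map I \<phi> g)"
    using assms(1)[of i] by (simp add: adj_coords_def induced_map_def graph_hom_def)
qed

text \<open>A coordinate in both sets would give a loop in its factor.\<close>

lemma adj_coords_Int_eq_coords:
  assumes "\<And>i. i \<in> I \<Longrightarrow> simple_graph (F i)"
  shows "adj_coords I F f g \<inter> eq_coords I f g = {}"
  using edge_distinct[OF assms] by (auto simp: adj_coords_def eq_coords_def)

text \<open>Two sets that cover \<open>I\<close> cannot grow properly inside disjoint subsets of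
  \<open>I\<close>. The maps \<open>\<phi> i\<close> supply the inclusions, looplessness of the
  \<open>H i\<close> the disjointness.\<close>

lemma coords_induced_map:
  assumes "\<And>i. i \<in> I \<Longrightarrow> simple_graph (H i)"
    and "\<And>i. i \<in> I \<Longrightarrow> graph_hom (G i) (H i) (\<phi> i)"
    and "f \<in> (\<Pi>\<^sub>E i\<in>I. verts (G i))" "g \<in> (\<Pi>\<^sub>E i\<in>I. verts (G i))"
    and "rest_coords I G f g = {}"
  shows "adj_coords I H (induced_map I \<phi> f) (induced_map I \<phi> g) = adj_coords I G f g"
    and "eq_coords I (induced_map I \<phi> f) (induced_map I \<phi> g) = eq_coords I f g"
    and "rest_coords I H (induced_map I \<phi> f) (induced_map I \<phi> g) = {}"
proof -
  let ?f = "induced_map I \<phi> f" and ?g = "induced_map I \<phi> g"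
  have cover: "I \<subseteq> adj_coords I G f g \<union> eq_coords I f g"
    using assms(5) by (auto simp: rest_coords_def)
  have adj: "adj_coords I G f g \<subseteq> adj_coords I H ?f ?g"
    by (intro adj_coords_subset_induced_map assms)
  have eq: "eq_coords I f g \<subseteq> eq_coords I ?f ?g"
    by (rule eq_coords_subset_induced_map)
  have disjoint: "adj_coords I H ?f ?g \<inter> eq_coords I ?f ?g = {}"
    by (intro adj_coords_Int_eq_coords assms)
  \<comment> \<open>These bounds let \<open>cover\<close> apply to coordinates of the images: a new
    member of one set would belong to the other set for \<open>f\<close> and \<open>g\<close>, hence
    to the other set for \<open>?f\<close> and \<open>?g\<close>, against
    \<open>disjoint\<close>.\<close>
  have "adj_coords I H ?f ?g \<subseteq> I" "eq_coords I ?f ?g \<subseteq> I"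
    by (auto simp: adj_coords_def eq_coords_def)
  with cover adj eq disjoint
  show "adj_coords I H ?f ?g = adj_coords I G f g" "eq_coords I ?f ?g = eq_coords I f g"
    by blast+
  then show "rest_coords I H ?f ?g = {}"
    using assms(5) by (simp add: rest_coords_def)
qed

theorem theorem3:
  fixes I :: "'i set"
    and C :: "('i set \<times> 'i set \<times> 'i set) set"
    and G :: "'i \<Rightarrow> 'a ugraph"
    and H :: "'i \<Rightarrow> 'b ugraph"
    and \<phi> :: "'i \<Rightarrow> 'a \<Rightarrow> 'b"
  assumes "C \<subseteq> Pow I \<times> Pow I \<times> Pow I"
    and "\<And>J K L. (J, K, L) \<in> C \<Longrightarrow> L = {}"
    and "\<And>i. i \<in> I \<Longrightarrow> simple_graph (G i)"
    and "\<And>i. i \<in> I \<Longrightarrow> simple_graph (H i)"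
    and "\<And>i. i \<in> I \<Longrightarrow> graph_hom (G i) (H i) (\<phi> i)"
  shows "graph_hom (product_process I C G) (product_process I C H) (induced_map I \<phi>)"
proof -
  let ?\<Phi> = "induced_map I \<phi>" and ?PG = "product_process I C G" and ?PH = "product_process I C H"
  have vertsG: "verts ?PG = (\<Pi>\<^sub>E i\<in>I. verts (G i))" and vertsH: "verts ?PH = (\<Pi>\<^sub>E i\<in>I. verts (H i))"
    by (simp_all add: product_process_def)
  have maps: "?\<Phi> f \<in> verts ?PH" if "f \<in> verts ?PG" for f
    using that assms(5) unfolding vertsG vertsH by (intro induced_map_in_PiE)
  have "{?\<Phi> f, ?\<Phi> g} \<in> edges ?PH"
    if fg: "f \<in> verts ?PG" "g \<in> verts ?PG" and edge: "{f, g} \<in> edges ?PG" for f g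
  proof -
    \<comment> \<open>\<open>graph_hom\<close> ranges over all pairs of vertices, whereas the
      adjacency criterion presupposes distinct ones.\<close>
    have "f \<noteq> g"
      using edge by (intro edge_distinct[OF simple_graph_product_process]) (use assms(3) in auto)
    with fg edge have inC: "(adj_coords I G f g, eq_coords I f g, rest_coords I G f g) \<in> C"
      by (simp add: product_process_adjacent_iff)
    then have rest: "rest_coords I G f g = {}"
      by (rule assms(2))
    note coords = coords_induced_map[OF assms(4,5) fg[unfolded vertsG] rest]
    \<comment> \<open>Members of \<open>PiE\<close> agree outside \<open>I\<close>, so distinct ones
      differ at an index in \<open>I\<close>.\<close>
    obtain i where "i \<in> I" "f i \<noteq> g i"
      using \<open>f \<noteq> g\<close> fg unfolding vertsG by (meson PiE_ext)
    \<comment> \<open>The maps \<open>\<phi> i\<close> may identify vertices, but here the set of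
      equal coordinates is unchanged, so the images still differ at \<open>i\<close>.\<close>
    then have "i \<notin> eq_coords I (?\<Phi> f) (?\<Phi> g)"
      by (subst coords(2)) (simp_all add: eq_coords_def)
    with \<open>i \<in> I\<close> have "?\<Phi> f \<noteq> ?\<Phi> g"
      by (auto simp: eq_coords_def)
    with inC show ?thesis
      by (simp add: product_process_adjacent_iff maps fg coords rest)
  qed
  with maps show ?thesis
    by (auto simp: graph_hom_def)
qed

end
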